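(* Let $G$ be a finite simple graph with minimum degree $\delta$ and maximum degree $\Delta$, independence number $\alpha(G)$ and matching number $\mu(G)$. Then $$\delta\,\alpha(G)\leq \Delta\,\mu(G).$$ Furthermore, if $\delta<\Delta$, then equality $\delta\,\alpha(G)=\Delta\,\mu(G)$ holds if and only if $G$ is bipartite and $(\delta,\Delta)$-regular.
   Context: $\alpha(G)$ denotes the maximum size of an independent set of $G$ and $\mu(G)$ the maximum size of a matching of $G$. For positive integers $\delta<\Delta$, a bipartite graph is called $(\delta,\Delta)$-regular if it has a bipartition with partite sets $A$ and $B$ such that every vertex in $A$ has degree $\delta$ and every vertex in $B$ has degree $\Delta$. *)

theory Defs
  imports Main
begin

locale fin_sgraph =
  fixes V :: "'a set" and E :: "'a set set"
  assumes finite_V: "finite V"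
    and edges: "e \<in> E \<Longrightarrow> e \<subseteq> V \<and> card e = 2"

definition degree :: "'a set set \<Rightarrow> 'a \<Rightarrow> nat" where
  "degree E v = card {e \<in> E. v \<in> e}"

(* Unspecified for the graph without vertices, since Min and Max are unspecified on {}. *)
definition min_degree :: "'a set \<Rightarrow> 'a set set \<Rightarrow> nat" where
  "min_degree V E = Min (degree E ` V)"

definition max_degree :: "'a set \<Rightarrow> 'a set set \<Rightarrow> nat" where
  "max_degree V E = Max (degree E ` V)"

definition independent_set :: "'a set \<Rightarrow> 'a set set \<Rightarrow> 'a set \<Rightarrow> bool" where
  "independent_set V E S \<longleftrightarrow> S \<subseteq> V \<and> (\<forall>u\<in>S. \<forall>v\<in>S. {u, v} \<notin> E)"

definition independence_number :: "'a set \<Rightarrow> 'a set set \<Rightarrow> nat" where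
  "independence_number V E = Max (card ` {S. independent_set V E S})"

definition matching :: "'a set set \<Rightarrow> 'a set set \<Rightarrow> bool" where
  "matching E M \<longleftrightarrow> M \<subseteq> E \<and> pairwise disjnt M"

definition matching_number :: "'a set set \<Rightarrow> nat" where
  "matching_number E = Max (card ` {M. matching E M})"

definition bipartition :: "'a set \<Rightarrow> 'a set set \<Rightarrow> 'a set \<Rightarrow> 'a set \<Rightarrow> bool" where
  "bipartition V E A B \<longleftrightarrow>
     A \<union> B = V \<and> A \<inter> B = {} \<and> (\<forall>e\<in>E. \<exists>a\<in>A. \<exists>b\<in>B. e = {a, b})"

definition bipartite :: "'a set \<Rightarrow> 'a set set \<Rightarrow> bool" where
  "bipartite V E \<longleftrightarrow> (\<exists>A B. bipartition V E A B)"

definition biregular :: "nat \<Rightarrow> nat \<Rightarrow> 'a set \<Rightarrow> 'a set set \<Rightarrow> bool" where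
  "biregular \<delta> \<Delta> V E \<longleftrightarrow> 0 < \<delta> \<and> \<delta> < \<Delta> \<and>
     (\<exists>A B. bipartition V E A B \<and>
        (\<forall>v\<in>A. degree E v = \<delta>) \<and> (\<forall>v\<in>B. degree E v = \<Delta>))"

end

theory Submission
  imports Defs
begin

text \<open>
  Let \<open>S\<close> be a maximum independent set and \<open>F\<close> the set of edges that meet \<open>S\<close>. Every edge of \<open>F\<close>
  has exactly one end in \<open>S\<close>, so \<open>F\<close> is bipartite and \<open>\<bar>F\<bar>\<close> is the degree sum over \<open>S\<close>.
  Koenig's theorem gives a vertex cover \<open>C\<close> of \<open>F\<close> with at most \<open>\<mu>\<close> elements, whence
  \<open>\<delta> \<alpha> \<le> \<bar>F\<bar> \<le> \<Delta> \<bar>C\<bar> \<le> \<Delta> \<mu>\<close>. In case of equality, all degrees in \<open>S\<close> are \<open>\<delta>\<close> and every vertex of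
  \<open>C\<close> lies on \<open>\<Delta>\<close> edges of \<open>F\<close>, so \<open>C\<close> avoids \<open>S\<close>; maximality of \<open>S\<close> forces \<open>C = V - S\<close>.
  Conversely, in a \<open>(\<delta>,\<Delta>)\<close>-regular graph with sides \<open>A\<close>, \<open>B\<close> we have \<open>\<alpha> \<ge> \<bar>A\<bar>\<close>, \<open>\<mu> \<le> \<bar>B\<bar>\<close> and
  \<open>\<delta> \<bar>A\<bar> = \<bar>E\<bar> = \<Delta> \<bar>B\<bar>\<close>.
\<close>

section \<open>Koenig's theorem for bipartite edge sets\<close>

text \<open>Finiteness matters because \<open>card\<close> is 0 on infinite sets, so an infinite
  cover would count as a small one.\<close>

definition vertex_cover :: "'a set set \<Rightarrow> 'a set \<Rightarrow> bool" where
  "vertex_cover F C \<longleftrightarrow> finite C \<and> (\<forall>e\<in>F. e \<inter> C \<noteq> {})"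

text \<open>
  The submodularity step in Lovasz's proof of Koenig's theorem: uncrossing covers of
  \<open>F - {e}\<close> and \<open>F - {f}\<close> gives two covers of \<open>F\<close>, and \<open>x\<close> has to be added only to one of them.
\<close>
lemma vertex_cover_uncross:
  assumes "A \<inter> B = {}" and F: "\<forall>e\<in>F. \<exists>a\<in>A. \<exists>b\<in>B. e = {a, b}"
    and "e \<in> F" "f \<in> F" "e \<noteq> f" "x \<in> A" "x \<in> e" "x \<in> f"
    and X: "vertex_cover (F - {e}) X" "card X < k"
    and Y: "vertex_cover (F - {f}) Y" "card Y < k"
  shows "\<exists>C. vertex_cover F C \<and> card C < k"
proof (cases "x \<in> X \<or> x \<in> Y")
  case True
  then show ?thesis
  proof
    assume "x \<in> X"
    then have "vertex_cover F X"
      using X \<open>x \<in> e\<close> unfolding vertex_cover_def by blast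
    then show ?thesis using X by blast
  next
    assume "x \<in> Y"
    then have "vertex_cover F Y"
      using Y \<open>x \<in> f\<close> unfolding vertex_cover_def by blast
    then show ?thesis using Y by blast
  qed
next
  case False
  then have xX: "x \<notin> X" and xY: "x \<notin> Y" by auto
  have fin: "finite X" "finite Y"
    using X Y by (auto simp: vertex_cover_def)
  have cX: "g \<inter> X \<noteq> {}" if "g \<in> F" "g \<noteq> e" for g
    using X that by (auto simp: vertex_cover_def)
  have cY: "g \<inter> Y \<noteq> {}" if "g \<in> F" "g \<noteq> f" for g
    using Y that by (auto simp: vertex_cover_def)
  \<comment> \<open>An edge meeting both \<open>X\<close> and \<open>Y\<close> has its
    \<open>B\<close>-end in \<open>X \<union> Y\<close> or its \<open>A\<close>-end in
    \<open>X \<inter> Y\<close>, and likewise with the sides exchanged. Only \<open>e\<close> and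
    \<open>f\<close> need separate care; \<open>x\<close> covers them in \<open>D\<close>.\<close>
  define C where "C = (A \<inter> (X \<inter> Y)) \<union> (B \<inter> (X \<union> Y))"
  define D where "D = insert x ((A \<inter> (X \<union> Y)) \<union> (B \<inter> (X \<inter> Y)))"
  have C: "vertex_cover F C"
    unfolding vertex_cover_def
  proof (intro conjI ballI)
    show "finite C" using fin by (simp add: C_def)
    fix g assume g: "g \<in> F"
    then obtain a b where ab: "a \<in> A" "b \<in> B" "g = {a, b}" using F by blast
    have "b \<in> X \<or> b \<in> Y \<or> a \<in> X \<inter> Y"
    proof (cases "g = e \<or> g = f")
      case True
      \<comment> \<open>The end of \<open>g\<close> in \<open>A\<close> is \<open>x\<close>, which
        lies outside \<open>X\<close> and \<open>Y\<close>. As \<open>e \<noteq> f\<close>, at least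
        one of \<open>X\<close>, \<open>Y\<close> still covers \<open>g\<close>, necessarily at
        \<open>b\<close>.\<close>
      then have "a = x"
        using ab \<open>x \<in> A\<close> \<open>x \<in> e\<close> \<open>x \<in> f\<close> \<open>A \<inter> B = {}\<close> by auto
      then show ?thesis
        using True cX[OF g] cY[OF g] ab xX xY \<open>e \<noteq> f\<close> by auto
    next
      case False
      then show ?thesis using cX[OF g] cY[OF g] ab by auto
    qed
    then show "g \<inter> C \<noteq> {}" using ab by (auto simp: C_def)
  qed
  have D: "vertex_cover F D"
    unfolding vertex_cover_def
  proof (intro conjI ballI)
    show "finite D" using fin by (simp add: D_def)
    fix g assume g: "g \<in> F"
    then obtain a b where ab: "a \<in> A" "b \<in> B" "g = {a, b}" using F by blast
    show "g \<inter> D \<noteq> {}"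
    proof (cases "g = e \<or> g = f")
      case True
      then show ?thesis using \<open>x \<in> e\<close> \<open>x \<in> f\<close> by (auto simp: D_def)
    next
      case False
      then show ?thesis using cX[OF g] cY[OF g] ab by (auto simp: D_def)
    qed
  qed
  have split: "card (A \<inter> Z) + card (B \<inter> Z) \<le> card Z" if "finite Z" for Z
  proof -
    have "card (A \<inter> Z) + card (B \<inter> Z) = card ((A \<inter> Z) \<union> (B \<inter> Z))"
      using that \<open>A \<inter> B = {}\<close> by (intro card_Un_disjoint[symmetric]) auto
    also have "\<dots> \<le> card Z" using that by (intro card_mono) auto
    finally show ?thesis .
  qed
  have modular: "card (Z \<inter> (X \<union> Y)) + card (Z \<inter> (X \<inter> Y)) = card (Z \<inter> X) + card (Z \<inter> Y)" for Z
    using card_Un_Int[of "Z \<inter> X" "Z \<inter> Y"] fin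
    by (simp add: Int_Un_distrib Int_left_commute Int_assoc)
  have "card C \<le> card (A \<inter> (X \<inter> Y)) + card (B \<inter> (X \<union> Y))"
    unfolding C_def by (rule card_Un_le)
  moreover have "card D \<le> Suc (card (A \<inter> (X \<union> Y)) + card (B \<inter> (X \<inter> Y)))"
    unfolding D_def by (rule order_trans[OF card_insert_le_m1]) (auto simp: card_Un_le)
  ultimately have "card C + card D \<le> Suc (card X + card Y)"
    using modular[of A] modular[of B] split[OF fin(1)] split[OF fin(2)] by linarith
  \<comment> \<open>Both cards are at most \<open>k - 1\<close>, so the sum is at most
    \<open>2 * k - 1\<close>, even with \<open>x\<close> counted.\<close>
  then have "card C < k \<or> card D < k"
    using X Y by linarith
  then show ?thesis using C D by blast
qed

text \<open>Edges are deleted as long as every cover keeps at least \<open>k\<close> elements. Once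
  no deletion is possible, uncrossing shows that the remaining edges are pairwise disjoint. Fixing
  \<open>k\<close> as a lower bound lets it pass unchanged through the induction.\<close>

lemma koenig:
  assumes "finite F" and "A \<inter> B = {}" and "\<forall>e\<in>F. \<exists>a\<in>A. \<exists>b\<in>B. e = {a, b}"
    and "\<And>C. vertex_cover F C \<Longrightarrow> k \<le> card C"
  shows "\<exists>M. matching F M \<and> k \<le> card M"
  using assms
proof (induction F rule: finite_psubset_induct)
  case (psubset F)
  show ?case
  proof (cases "\<exists>e\<in>F. \<forall>C. vertex_cover (F - {e}) C \<longrightarrow> k \<le> card C")
    case True
    then obtain e where "e \<in> F" "\<forall>C. vertex_cover (F - {e}) C \<longrightarrow> k \<le> card C" by blast
    then have "\<exists>M. matching (F - {e}) M \<and> k \<le> card M"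
      using psubset.prems by (intro psubset.IH) auto
    then show ?thesis by (auto simp: matching_def)
  next
    case False
    have "pairwise disjnt F"
    proof (rule ccontr)
      assume "\<not> pairwise disjnt F"
      then obtain e f x where ef: "e \<in> F" "f \<in> F" "e \<noteq> f" "x \<in> e" "x \<in> f"
        by (auto simp: pairwise_def disjnt_def)
      obtain X Y where X: "vertex_cover (F - {e}) X" "card X < k"
        and Y: "vertex_cover (F - {f}) Y" "card Y < k"
        using False ef by (meson not_le)
      obtain a b where "a \<in> A" "b \<in> B" "e = {a, b}"
        using psubset.prems(2) ef(1) by blast
      then have "x \<in> A \<or> x \<in> B" using ef(4) by auto
      then have "\<exists>C. vertex_cover F C \<and> card C < k"
      proof
        assume "x \<in> A"
        then show ?thesis
          by (rule vertex_cover_uncross[OF psubset.prems(1,2) ef(1-3) _ ef(4,5) X Y])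
      next
        \<comment> \<open>The shared vertex may lie on either side; here the two sides trade
          roles.\<close>
        have BA: "B \<inter> A = {}" using psubset.prems(1) by blast
        have FBA: "\<forall>e\<in>F. \<exists>a\<in>B. \<exists>b\<in>A. e = {a, b}"
          using psubset.prems(2) by (metis insert_commute)
        assume "x \<in> B"
        then show ?thesis
          by (rule vertex_cover_uncross[OF BA FBA ef(1-3) _ ef(4,5) X Y])
      qed
      then show False using psubset.prems(3) by (meson not_le)
    qed
    moreover have "k \<le> card F"
    proof -
      \<comment> \<open>One chosen end per edge gives a cover, so \<open>F\<close>, now a matching,
        is large enough.\<close>
      obtain a where a: "\<And>e. e \<in> F \<Longrightarrow> a e \<in> e"
        using psubset.prems(2) by (metis insertI1)
      then have "vertex_cover F (a ` F)"
        using psubset.hyps by (auto simp: vertex_cover_def)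
      then have "k \<le> card (a ` F)" by (rule psubset.prems(3))
      also have "\<dots> \<le> card F" using psubset.hyps by (rule card_image_le)
      finally show ?thesis .
    qed
    ultimately show ?thesis by (auto simp: matching_def)
  qed
qed

section \<open>Counting along vertex sets and covers\<close>

text \<open>Serves the equality case, with a lower bound on the degrees over \<open>S\<close> and an
  upper bound over the cover.\<close>

lemma sum_eq_card_mult_imp_eq:
  fixes f :: "'a \<Rightarrow> nat"
  assumes "finite A" "sum f A = card A * c" "(\<forall>x\<in>A. f x \<le> c) \<or> (\<forall>x\<in>A. c \<le> f x)" "x \<in> A"
  shows "f x = c"
proof -
  have eq: "sum f A = sum (\<lambda>_. c) A" using assms(2) by simp
  from assms(3) show ?thesis
  proof
    assume "\<forall>x\<in>A. f x \<le> c"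
    then show ?thesis using sum_mono_inv[OF eq _ \<open>x \<in> A\<close> \<open>finite A\<close>] by blast
  next
    assume "\<forall>x\<in>A. c \<le> f x"
    then show ?thesis using sum_mono_inv[OF eq[symmetric] _ \<open>x \<in> A\<close> \<open>finite A\<close>] by simp
  qed
qed

text \<open>Double counting of incidences: each edge is counted at its only vertex in
  \<open>A\<close>.\<close>

lemma sum_degree_eq_card:
  assumes "finite A" "finite F" "\<And>e. e \<in> F \<Longrightarrow> \<exists>a. e \<inter> A = {a}"
  shows "sum (degree F) A = card F"
proof -
  have "card {a \<in> A. a \<in> e} = 1" if "e \<in> F" for e
  proof -
    have "{a \<in> A. a \<in> e} = e \<inter> A" by blast
    then show ?thesis using assms(3)[OF that] by auto
  qed
  then show ?thesis
    using sum_multicount[of A F "\<lambda>a e. a \<in> e" 1] assms by (simp add: degree_def)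
qed

lemma card_le_sum_degree_cover:
  assumes "finite F" "vertex_cover F C"
  shows "card F \<le> sum (degree F) C"
proof -
  have "card F \<le> card (\<Union>v\<in>C. {e \<in> F. v \<in> e})"
    using assms by (intro card_mono) (auto simp: vertex_cover_def)
  also have "\<dots> \<le> sum (degree F) C"
    unfolding degree_def using assms by (intro card_UN_le) (simp add: vertex_cover_def)
  finally show ?thesis .
qed

lemma bipartition_Int:
  assumes "bipartition V E A B" "e \<in> E"
  shows "\<exists>a. e \<inter> A = {a}" "\<exists>b. e \<inter> B = {b}"
proof -
  obtain a b where "a \<in> A" "b \<in> B" "e = {a, b}"
    using assms unfolding bipartition_def by blast
  moreover have "A \<inter> B = {}" using assms(1) by (simp add: bipartition_def)
  ultimately have "e \<inter> A = {a}" "e \<inter> B = {b}" by auto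
  then show "\<exists>a. e \<inter> A = {a}" "\<exists>b. e \<inter> B = {b}" by blast+
qed

text \<open>Weak duality: disjoint edges are covered by distinct vertices.\<close>

lemma matching_card_le_cover:
  assumes "matching F M" "vertex_cover F C"
  shows "card M \<le> card C"
proof -
  have "\<forall>e\<in>M. \<exists>v. v \<in> e \<inter> C"
    using assms unfolding matching_def vertex_cover_def by blast
  then obtain c where c: "\<And>e. e \<in> M \<Longrightarrow> c e \<in> e \<inter> C" by metis
  have "inj_on c M"
  proof (rule inj_onI)
    fix e f assume "e \<in> M" "f \<in> M" "c e = c f"
    then have "\<not> disjnt e f" using c[of e] c[of f] by (auto simp: disjnt_def)
    then show "e = f"
      using assms(1) \<open>e \<in> M\<close> \<open>f \<in> M\<close> by (auto simp: matching_def pairwise_def)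
  qed
  moreover have "c ` M \<subseteq> C" using c by blast
  ultimately show ?thesis
    using assms(2) by (simp add: card_inj_on_le vertex_cover_def)
qed

section \<open>Extremal parameters of a finite simple graph\<close>

context fin_sgraph
begin

lemma finite_E: "finite E"
  using finite_V edges by (meson Pow_iff finite_Pow_iff finite_subset subsetI)

lemma min_degree_le: "v \<in> V \<Longrightarrow> min_degree V E \<le> degree E v"
  unfolding min_degree_def using finite_V by simp

lemma degree_le_max_degree: "v \<in> V \<Longrightarrow> degree E v \<le> max_degree V E"
  unfolding max_degree_def using finite_V by simp

lemma finite_independent_sets: "finite {S. independent_set V E S}"
  using finite_V by (rule_tac finite_subset[of _ "Pow V"]) (auto simp: independent_set_def)

lemma card_le_independence_number:
  "independent_set V E S \<Longrightarrow> card S \<le> independence_number V E"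
  unfolding independence_number_def using finite_independent_sets by simp

lemma obtain_maximum_independent_set:
  obtains S where "independent_set V E S" "card S = independence_number V E"
proof -
  have "independent_set V E {}" by (simp add: independent_set_def)
  then have "independence_number V E \<in> card ` {S. independent_set V E S}"
    unfolding independence_number_def using finite_independent_sets by (intro Max_in) auto
  then show ?thesis using that by auto
qed

lemma finite_matchings: "finite {M. matching E M}"
  using finite_E by (rule_tac finite_subset[of _ "Pow E"]) (auto simp: matching_def)

lemma card_le_matching_number: "matching E M \<Longrightarrow> card M \<le> matching_number E"
  unfolding matching_number_def using finite_matchings by simp

lemma matching_number_le_cover:
  assumes "vertex_cover E C"
  shows "matching_number E \<le> card C"
proof -
  have "matching E {}" by (simp add: matching_def)
  then show ?thesis
    unfolding matching_number_def using finite_matchings matching_card_le_cover[OF _ assms]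
    by (intro Max.boundedI) auto
qed

lemma obtain_small_cover:
  assumes "A \<inter> B = {}" "F \<subseteq> E" "\<forall>e\<in>F. \<exists>a\<in>A. \<exists>b\<in>B. e = {a, b}"
  obtains C where "vertex_cover F C" "C \<subseteq> V" "card C \<le> matching_number E"
proof -
  have "finite F" using assms(2) finite_E by (rule finite_subset)
  have "\<exists>C. vertex_cover F C \<and> card C \<le> matching_number E"
  proof (rule ccontr)
    assume "\<not> ?thesis"
    \<comment> \<open>If all covers exceeded the matching number, Koenig's theorem would give a
      matching with one edge too many.\<close>
    then have "\<exists>M. matching F M \<and> Suc (matching_number E) \<le> card M"
      using koenig[OF \<open>finite F\<close> assms(1,3)] by (meson not_less_eq_eq)
    then obtain M where "matching F M" "Suc (matching_number E) \<le> card M" by blast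
    moreover from this have "matching E M" using assms(2) by (auto simp: matching_def)
    ultimately show False using card_le_matching_number by fastforce
  qed
  then obtain C where C: "vertex_cover F C" "card C \<le> matching_number E" by blast
  \<comment> \<open>Cutting the cover down to \<open>V\<close> makes the maximum degree bound apply
    to its elements.\<close>
  have "e \<inter> (C \<inter> V) = e \<inter> C" if "e \<in> F" for e
    using edges[of e] assms(2) that by auto
  then have "vertex_cover F (C \<inter> V)"
    using C(1) by (simp add: vertex_cover_def)
  moreover have "card (C \<inter> V) \<le> matching_number E"
    using C by (meson card_mono inf_le1 order_trans vertex_cover_def)
  ultimately show ?thesis using that by blast
qed

lemma edge_obtain:
  assumes "e \<in> E" "u \<in> e"
  obtains v where "e = {u, v}" "v \<noteq> u" "v \<in> V" "u \<in> V"
proof -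
  obtain x y where "e = {x, y}" "x \<noteq> y" using edges[OF assms(1)] by (auto simp: card_2_iff)
  then show ?thesis using assms edges[OF assms(1)] that[of x] that[of y] by auto
qed

lemma edges_meeting_independent_set:
  assumes "independent_set V E S" "e \<in> E" "e \<inter> S \<noteq> {}"
  shows "\<exists>a\<in>S. \<exists>b\<in>V - S. e = {a, b}"
proof -
  obtain a where a: "a \<in> e" "a \<in> S" using assms(3) by blast
  obtain b where b: "e = {a, b}" "b \<in> V" using edge_obtain[OF assms(2) a(1)] by blast
  then have "b \<notin> S" using assms(1,2) a by (auto simp: independent_set_def)
  then show ?thesis using a b by blast
qed

lemma maximum_independent_set_dominating:
  assumes "independent_set V E S" "card S = independence_number V E" "v \<in> V - S"
  shows "\<exists>s\<in>S. {v, s} \<in> E"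
proof (rule ccontr)
  assume "\<not> ?thesis"
  then have "\<forall>s\<in>S. {v, s} \<notin> E \<and> {s, v} \<notin> E" by (simp add: insert_commute)
  \<comment> \<open>\<open>independent_set\<close> also tests \<open>u = v\<close>, where
    \<open>{u, v}\<close> collapses to a singleton.\<close>
  moreover have "{v} \<notin> E" using edges[of "{v}"] by auto
  ultimately have "independent_set V E (insert v S)"
    using assms by (auto simp: independent_set_def)
  then have "card (insert v S) \<le> card S"
    using card_le_independence_number assms(2) by metis
  moreover have "finite S"
    using assms(1) finite_V by (auto simp: independent_set_def intro: finite_subset)
  ultimately show False using assms(3) by simp
qed

lemma matching_number_pos:
  assumes "0 < max_degree V E" "V \<noteq> {}"
  shows "0 < matching_number E"
proof -
  have "max_degree V E \<in> degree E ` V"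
    unfolding max_degree_def using finite_V assms(2) by (intro Max_in) auto
  then obtain v where "0 < degree E v" using assms(1) by auto
  then obtain e where "e \<in> E" unfolding degree_def by (auto simp: card_gt_0_iff)
  then have "matching E {e}" by (simp add: matching_def)
  then show ?thesis using card_le_matching_number by fastforce
qed

section \<open>The inequality and the structure forced by equality\<close>

lemma independence_matching_main:
  shows "min_degree V E * independence_number V E \<le> max_degree V E * matching_number E"
    and "\<lbrakk>min_degree V E * independence_number V E = max_degree V E * matching_number E;
          min_degree V E < max_degree V E; V \<noteq> {}\<rbrakk>
      \<Longrightarrow> biregular (min_degree V E) (max_degree V E) V E"
proof -
  let ?\<delta> = "min_degree V E" and ?\<Delta> = "max_degree V E"
  obtain S where S: "independent_set V E S" "card S = independence_number V E"
    by (rule obtain_maximum_independent_set)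
  have SV: "S \<subseteq> V" and finS: "finite S"
    using S(1) finite_V by (auto simp: independent_set_def intro: finite_subset)
  define F where "F = {e \<in> E. e \<inter> S \<noteq> {}}"
  have FE: "F \<subseteq> E" by (auto simp: F_def)
  have finF: "finite F" using FE finite_E by (rule finite_subset)
  have Fbip: "\<forall>e\<in>F. \<exists>a\<in>S. \<exists>b\<in>V - S. e = {a, b}"
    using edges_meeting_independent_set[OF S(1)] by (auto simp: F_def)
  obtain C where C: "vertex_cover F C" "C \<subseteq> V" "card C \<le> matching_number E"
    using obtain_small_cover[of S "V - S" F] FE Fbip by blast
  have finC: "finite C" using C(1) by (simp add: vertex_cover_def)
  have degS: "degree F s = degree E s" if "s \<in> S" for s
  proof -
    have "{e \<in> F. s \<in> e} = {e \<in> E. s \<in> e}" using that by (auto simp: F_def)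
    then show ?thesis by (simp add: degree_def)
  qed
  have degF: "degree F v \<le> degree E v" for v
    unfolding degree_def using FE finite_E by (intro card_mono) auto
  have degFC: "degree F v \<le> ?\<Delta>" if "v \<in> C" for v
    using degF[of v] degree_le_max_degree[of v] that C(2) by (meson order_trans subsetD)
  have degSmin: "?\<delta> \<le> degree F s" if "s \<in> S" for s
    using that SV min_degree_le degS by (metis subsetD)
  have cardF: "sum (degree F) S = card F"
    using Fbip by (intro sum_degree_eq_card finS finF) fastforce
  have 1: "card S * ?\<delta> \<le> sum (degree F) S"
    using sum_bounded_below[of S ?\<delta> "degree F"] degSmin by simp
  have 2: "sum (degree F) S \<le> sum (degree F) C"
    using card_le_sum_degree_cover[OF finF C(1)] cardF by simp
  have 3: "sum (degree F) C \<le> card C * ?\<Delta>"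
    using sum_bounded_above[of C "degree F" ?\<Delta>] degFC by simp
  have 4: "card C * ?\<Delta> \<le> ?\<Delta> * matching_number E"
    using C(3) by simp
  show "?\<delta> * independence_number V E \<le> ?\<Delta> * matching_number E"
    using 1 2 3 4 unfolding S(2) by (metis mult.commute order_trans)
  assume eq: "?\<delta> * independence_number V E = ?\<Delta> * matching_number E"
    and less: "?\<delta> < ?\<Delta>" and "V \<noteq> {}"
  have "card S * ?\<delta> = ?\<Delta> * matching_number E" using eq S(2) by (simp add: mult.commute)
  \<comment> \<open>The assumed equality joins both ends of the chain \<open>1\<close> to
    \<open>4\<close>, so every link is tight.\<close>
  then have sums: "sum (degree F) S = card S * ?\<delta>" "sum (degree F) C = card C * ?\<Delta>"
    using 1 2 3 4 by linarith+
  have dS: "degree F s = ?\<delta>" if "s \<in> S" for s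
    using sum_eq_card_mult_imp_eq[OF finS sums(1) _ that] degSmin by blast
  have dC: "degree F v = ?\<Delta>" if "v \<in> C" for v
    using sum_eq_card_mult_imp_eq[OF finC sums(2) _ that] degFC by blast
  \<comment> \<open>A common vertex would have both degrees \<delta> and \<Delta> in
    \<open>F\<close>.\<close>
  have "S \<inter> C = {}" using dS dC less by fastforce
  have VS: "v \<in> C" if v: "v \<in> V - S" for v
  proof -
    obtain s where s: "s \<in> S" "{v, s} \<in> E"
      using maximum_independent_set_dominating[OF S v] by blast
    then have "{v, s} \<inter> C \<noteq> {}"
      using C(1) by (auto simp: F_def vertex_cover_def)
    then show ?thesis using s \<open>S \<inter> C = {}\<close> by blast
  qed
  have degC: "degree E v = ?\<Delta>" if "v \<in> C" for v
    using dC[OF that] degF[of v] degree_le_max_degree[of v] that C(2) by fastforce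
  \<comment> \<open>An edge with an end \<open>v\<close> outside \<open>S\<close> has
    \<open>v\<close> in \<open>C\<close>. There the degrees in \<open>F\<close> and \<open>E\<close>
    agree, so all edges at \<open>v\<close> belong to \<open>F\<close>.\<close>
  have "E \<subseteq> F"
  proof
    fix e assume e: "e \<in> E"
    then have "e \<subseteq> V" "e \<noteq> {}" using edges[OF e] by auto
    then obtain v where v: "v \<in> e" "v \<in> V" by blast
    show "e \<in> F"
    proof (cases "v \<in> S")
      case True
      then show ?thesis using e v by (auto simp: F_def)
    next
      case False
      then have "v \<in> C" using VS v by blast
      then have "card {e \<in> F. v \<in> e} = card {e \<in> E. v \<in> e}"
        using dC degC by (simp add: degree_def)
      then have "{e \<in> F. v \<in> e} = {e \<in> E. v \<in> e}"
        using FE finite_E by (intro card_subset_eq) auto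
      then show ?thesis using e v by blast
    qed
  qed
  then have "bipartition V E S (V - S)"
    using Fbip SV unfolding bipartition_def by blast
  moreover have "\<forall>v\<in>S. degree E v = ?\<delta>" using dS degS by simp
  moreover have "\<forall>v\<in>V - S. degree E v = ?\<Delta>" using VS degC by blast
  \<comment> \<open>With \<delta> = 0 the equality would read 0 = \<Delta> \<mu>, although both
    factors are positive.\<close>
  moreover have "0 < ?\<delta>"
    using eq less matching_number_pos[OF _ \<open>V \<noteq> {}\<close>] by (cases "?\<delta> = 0") auto
  ultimately show "biregular ?\<delta> ?\<Delta> V E"
    using less unfolding biregular_def by blast
qed

text \<open>Both sides are compared with the number of edges, counted once from \<open>A\<close> and
  once from \<open>B\<close>. Together with the general inequality this yields equality.\<close>

lemma biregular_le:
  assumes "biregular d D V E"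
  shows "D * matching_number E \<le> d * independence_number V E"
proof -
  obtain A B where AB: "bipartition V E A B"
    and A: "\<forall>v\<in>A. degree E v = d" and B: "\<forall>v\<in>B. degree E v = D"
    using assms by (auto simp: biregular_def)
  have fin: "finite A" "finite B"
    using AB finite_V by (auto simp: bipartition_def)
  have "independent_set V E A"
    using AB unfolding bipartition_def independent_set_def by (fastforce simp: doubleton_eq_iff)
  then have "card A \<le> independence_number V E" by (rule card_le_independence_number)
  moreover have "vertex_cover E B"
    using bipartition_Int(2)[OF AB] fin by (fastforce simp: vertex_cover_def)
  then have "matching_number E \<le> card B" by (rule matching_number_le_cover)
  moreover have "d * card A = card E"
    using sum_degree_eq_card[OF fin(1) finite_E bipartition_Int(1)[OF AB]] A by (simp add: mult.commute)
  moreover have "D * card B = card E"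
    using sum_degree_eq_card[OF fin(2) finite_E bipartition_Int(2)[OF AB]] B by (simp add: mult.commute)
  ultimately show ?thesis by (metis mult_le_mono2 order_trans)
qed

end

theorem theorem1:
  fixes V :: "'a set" and E :: "'a set set" and \<delta> \<Delta> :: nat
  assumes "fin_sgraph V E" and "V \<noteq> {}"
    and "\<delta> = min_degree V E" and "\<Delta> = max_degree V E"
  shows "\<delta> * independence_number V E \<le> \<Delta> * matching_number E \<and>
    (\<delta> < \<Delta> \<longrightarrow>
      (\<delta> * independence_number V E = \<Delta> * matching_number E \<longleftrightarrow>
        bipartite V E \<and> biregular \<delta> \<Delta> V E))"
proof -
  interpret fin_sgraph V E by (rule assms(1))
  have "bipartite V E" if "biregular \<delta> \<Delta> V E"
    using that by (auto simp: biregular_def bipartite_def)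
  then show ?thesis
    using independence_matching_main(1) independence_matching_main(2)[OF _ _ assms(2)]
      biregular_le[of \<delta> \<Delta>] le_antisym
    unfolding assms(3,4) by blast
qed

end
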